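(* Let $K=(k(1),\dots,k(n))\in\mathbb{Z}_{\ge0}^n$, $K\neq0$, and $d^K=\prod_{i=1}^n d_{n,i}^{k(i)}$. Then there exist a composite $P(\Gamma,K)$ of Steenrod reduced power operations, a natural number $m$ and a nonzero scalar $u\in\mathbb{F}_p$ such that $P(\Gamma,K)\,d^K=u\,d_{n,n}^{p^m}$.
   Context: Let $p$ be a prime and $\mathbb{F}_p=\mathbb{Z}/p\mathbb{Z}$. The Dickson algebra $\mathbb{F}_p[y_1,\dots,y_n]^{GL_n(\mathbb{F}_p)}=\mathbb{F}_p[d_{n,1},\dots,d_{n,n}]$ is the polynomial algebra on the Dickson invariants $d_{n,i}$ (the coefficients, up to sign, of $\prod_{v\in \mathbb{F}_p\langle y_1,\dots,y_n\rangle}(X-v)=X^{p^n}+\sum_{i}(-1)^i d_{n,i}X^{p^{n-i}}$), with $|d_{n,i}|=2(p^n-p^{n-i})$ for $p$ odd ($|y_i|=2$) and $2^n-2^{n-i}$ for $p=2$ ($|y_i|=1$). The mod $p$ Steenrod algebra acts by reduced powers $P^r$ (for $p=2$, $P^r$ means $Sq^r$); composites are applied right to left. *)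

theory Defs
  imports "HOL-Library.Poly_Mapping" "HOL-Computational_Algebra.Polynomial"
begin

text \<open>Polynomial ring k[y_1, y_2, ...]: coefficient functions on monomials
  (exponent vectors nat =>0 nat). The variable y_i is indexed by i (we use i in 1..n).\<close>

type_synonym 'k mpol = "(nat \<Rightarrow>\<^sub>0 nat) \<Rightarrow>\<^sub>0 'k"

definition yvar :: "nat \<Rightarrow> 'k::comm_ring_1 mpol" where
  "yvar i = Poly_Mapping.single (Poly_Mapping.single i 1) 1"

definition const_mpol :: "'k::comm_ring_1 \<Rightarrow> 'k mpol" where
  "const_mpol c = Poly_Mapping.single 0 c"

definition lin_span :: "nat \<Rightarrow> 'k::comm_ring_1 mpol set" where
  "lin_span n = {v. \<exists>c :: nat \<Rightarrow> 'k. v = (\<Sum>i=1..n. const_mpol (c i) * yvar i)}"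

definition dickson_poly :: "nat \<Rightarrow> 'k::comm_ring_1 mpol poly" where
  "dickson_poly n = (\<Prod>v\<in>lin_span n. [:- v, 1:])"

text \<open>X^{p^n} + sum_i (-1)^i d_{n,i} X^{p^{n-i}}, so d_{n,i} = (-1)^i coeff at p^(n-i).\<close>
definition dickson :: "nat \<Rightarrow> nat \<Rightarrow> nat \<Rightarrow> 'k::comm_ring_1 mpol" where
  "dickson p n i = (-1) ^ i * coeff (dickson_poly n) (p ^ (n - i))"

text \<open>Reduced power P^r (Sq^r for p = 2), determined by P^r(y) = y^p for r = 1,
  y for r = 0, 0 otherwise, and the Cartan formula; explicitly on monomials
  P^r(y^a) = sum_{|s| = r} prod_i binom(a_i, s_i) y^(a + (p-1) s), extended linearly.\<close>
definition steenrod_mono :: "nat \<Rightarrow> nat \<Rightarrow> (nat \<Rightarrow>\<^sub>0 nat) \<Rightarrow> 'k::comm_ring_1 mpol" where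
  "steenrod_mono p r a =
     (\<Sum>s\<in>{s :: nat \<Rightarrow>\<^sub>0 nat. (\<forall>i. Poly_Mapping.lookup s i \<le> Poly_Mapping.lookup a i) \<and> (\<Sum>i\<in>Poly_Mapping.keys a. Poly_Mapping.lookup s i) = r}.
        Poly_Mapping.single (a + Poly_Mapping.map (\<lambda>x. (p - 1) * x) s)
          (of_nat (\<Prod>i\<in>Poly_Mapping.keys a. Poly_Mapping.lookup a i choose Poly_Mapping.lookup s i)))"

definition steenrod :: "nat \<Rightarrow> nat \<Rightarrow> 'k::comm_ring_1 mpol \<Rightarrow> 'k mpol" where
  "steenrod p r f = (\<Sum>a\<in>Poly_Mapping.keys f. const_mpol (Poly_Mapping.lookup f a) * steenrod_mono p r a)"

definition steenrod_comp :: "nat \<Rightarrow> nat list \<Rightarrow> 'k::comm_ring_1 mpol \<Rightarrow> 'k mpol" where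
  "steenrod_comp p rs f = foldr (steenrod p) rs f"

end

theory Submission
  imports Defs "HOL-Computational_Algebra.Primes" "HOL-Library.FuncSet"
begin

text \<open>
  Write \<open>c\<^sub>k\<close> for the coefficient of \<open>X^(p^k)\<close> in the Dickson polynomial of rank \<open>n\<close>, so that
  \<open>c\<^sub>k = \<plusminus> d\<^sub>n\<^sub>,\<^sub>n\<^sub>-\<^sub>k\<close>. The total operation \<open>\<Phi> = \<Sum>\<^sub>r t^r P^r\<close> is a ring homomorphism, and applying it
  to the Dickson polynomial gives \<open>P^r c\<^sub>k = 0\<close> for \<open>0 < r < p^(k-1)\<close> and
  \<open>P^(p^(k-1)) c\<^sub>k = - c\<^sub>k\<^sub>-\<^sub>1\<close>, while \<open>c\<^sub>0\<close> is only moved from \<open>r = p^(n-1)\<close> on, where it is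
  multiplied by \<open>c\<^sub>n\<^sub>-\<^sub>1\<close>. Since \<open>P^1\<close> kills \<open>p\<close>-th powers, the cascade
  \<open>P^1 P^p \<cdots> P^(p^(i-1))\<close> is insensitive to \<open>p\<close>-th power factors and trades one \<open>c\<^sub>i\<close> of a monomial
  for a \<open>c\<^sub>0\<close> (times the exponent of \<open>c\<^sub>i\<close>); with \<open>i = n\<close> it multiplies by \<open>c\<^sub>0\<close> (times the exponent
  of \<open>c\<^sub>0\<close>). Hence all exponents can be made divisible by \<open>p\<close>, the exponent sum being only
  rounded up to a multiple of \<open>p\<close>. As \<open>P^(pr) (f^p) = (P^r f)^p\<close>, one may then extract a \<open>p\<close>-th
  root and induct on the exponent sum.
\<close>

section \<open>The total Steenrod operation\<close>

lemma yvar_power: "(yvar i :: 'k::comm_ring_1 mpol) ^ e = Poly_Mapping.single (Poly_Mapping.single i e) 1"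
proof (induction e)
  case (Suc e)
  then show ?case
    by (simp add: yvar_def mult_single single_add[symmetric])
qed simp

lemma prod_single:
  "(\<Prod>i\<in>A. Poly_Mapping.single (m i) (f i :: 'k::comm_ring_1)) =
     Poly_Mapping.single (\<Sum>i\<in>A. m i :: nat \<Rightarrow>\<^sub>0 nat) (\<Prod>i\<in>A. f i)"
  by (induction A rule: infinite_finite_induct) (simp_all add: mult_single)

lemma sum_keys_single:
  fixes a s :: "nat \<Rightarrow>\<^sub>0 nat"
  assumes "\<And>i. Poly_Mapping.lookup s i \<le> Poly_Mapping.lookup a i"
  shows "(\<Sum>i\<in>Poly_Mapping.keys a. Poly_Mapping.single i (Poly_Mapping.lookup a i + q * Poly_Mapping.lookup s i)) =
           a + Poly_Mapping.map (\<lambda>x. q * x) s"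
proof (rule poly_mapping_eqI)
  fix k
  have "Poly_Mapping.lookup (\<Sum>i\<in>Poly_Mapping.keys a. Poly_Mapping.single i (Poly_Mapping.lookup a i + q * Poly_Mapping.lookup s i)) k =
          (\<Sum>i\<in>Poly_Mapping.keys a. if k = i then Poly_Mapping.lookup a i + q * Poly_Mapping.lookup s i else 0)"
    by (auto simp: lookup_sum lookup_single when_def intro!: sum.cong)
  also have "\<dots> = Poly_Mapping.lookup a k + q * Poly_Mapping.lookup s k"
    using assms[of k] by (auto simp: in_keys_iff)
  finally show "Poly_Mapping.lookup (\<Sum>i\<in>Poly_Mapping.keys a. Poly_Mapping.single i (Poly_Mapping.lookup a i + q * Poly_Mapping.lookup s i)) k =
      Poly_Mapping.lookup (a + Poly_Mapping.map (\<lambda>x. q * x) s) k"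
    by (simp add: lookup_add Poly_Mapping.map.rep_eq when_def)
qed

text \<open>The variable of the outer polynomial is the bookkeeping variable t. This is the image of
  the monomial under the substitution y_i -> y_i + t*y_i^p, a form in which multiplicativity is
  immediate.\<close>

definition total_mono :: "nat \<Rightarrow> (nat \<Rightarrow>\<^sub>0 nat) \<Rightarrow> 'k::comm_ring_1 mpol poly" where
  "total_mono p a = (\<Prod>i\<in>Poly_Mapping.keys a. [:yvar i, yvar i ^ p:] ^ Poly_Mapping.lookup a i)"

definition total_steenrod :: "nat \<Rightarrow> 'k::comm_ring_1 mpol \<Rightarrow> 'k mpol poly" where
  "total_steenrod p f = (\<Sum>a\<in>Poly_Mapping.keys f. [:const_mpol (Poly_Mapping.lookup f a):] * total_mono p a)"

lemma linear_power:
  fixes x y :: "'a::comm_ring_1"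
  shows "[:x, y:] ^ m = (\<Sum>j\<le>m. monom (of_nat (m choose j) * (y ^ j * x ^ (m - j))) j)"
proof -
  have "[:x, y:] = monom y 1 + [:x:]" by (simp add: monom_altdef)
  hence "[:x, y:] ^ m = (\<Sum>j\<le>m. of_nat (m choose j) * monom y 1 ^ j * [:x:] ^ (m - j))"
    by (simp only: binomial_ring)
  also have "\<dots> = (\<Sum>j\<le>m. monom (of_nat (m choose j) * (y ^ j * x ^ (m - j))) j)"
    by (intro sum.cong refl)
      (simp add: monom_power poly_const_pow of_nat_poly mult_monom smult_monom
        mult.assoc mult.commute)
  finally show ?thesis .
qed

lemma prod_monom: "(\<Prod>i\<in>A. monom (c i :: 'a::comm_ring_1) (e i)) = monom (\<Prod>i\<in>A. c i) (\<Sum>i\<in>A. e i)"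
  by (induction A rule: infinite_finite_induct) (simp_all add: mult_monom)

text \<open>Expanding every factor by the binomial theorem and multiplying out gives one term for
  each choice of s_i in 0..a_i; the coefficient of t^r collects the choices with sum r.\<close>

lemma coeff_total_mono:
  assumes "p > 0"
  shows "coeff (total_mono p a :: 'k::comm_ring_1 mpol poly) r = steenrod_mono p r a"
proof -
  define G where "G = PiE (Poly_Mapping.keys a) (\<lambda>i. {..Poly_Mapping.lookup a i})"
  have lin: "[:yvar i, yvar i ^ p:] ^ m =
     (\<Sum>j\<le>m. monom (Poly_Mapping.single (Poly_Mapping.single i (m + (p - 1) * j))
        (of_nat (m choose j) :: 'k)) j)" for i m
  proof -
    have "of_nat (m choose j) * ((yvar i ^ p) ^ j * yvar i ^ (m - j)) =
        Poly_Mapping.single (Poly_Mapping.single i (m + (p - 1) * j)) (of_nat (m choose j) :: 'k)"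
      if "j \<le> m" for j
    proof -
      have "p * j + (m - j) = m + (p - 1) * j"
        using that assms by (cases p) auto
      hence "(yvar i ^ p) ^ j * yvar i ^ (m - j) = (yvar i :: 'k mpol) ^ (m + (p - 1) * j)"
        by (simp only: power_mult[symmetric] power_add[symmetric])
      also have "\<dots> = Poly_Mapping.single (Poly_Mapping.single i (m + (p - 1) * j)) 1"
        by (rule yvar_power)
      finally have "(yvar i ^ p) ^ j * yvar i ^ (m - j) =
          (Poly_Mapping.single (Poly_Mapping.single i (m + (p - 1) * j)) 1 :: 'k mpol)" .
      thus ?thesis
        by (simp only:) (simp add: mult_single flip: single_of_nat)
    qed
    thus ?thesis by (simp add: linear_power)
  qed
  have fin: "finite G" unfolding G_def by (intro finite_PiE) auto
  have "total_mono p a = (\<Sum>s\<in>G. \<Prod>i\<in>Poly_Mapping.keys a. monom (Poly_Mapping.single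
          (Poly_Mapping.single i (Poly_Mapping.lookup a i + (p - 1) * s i)) (of_nat (Poly_Mapping.lookup a i choose s i) :: 'k)) (s i))"
    unfolding total_mono_def lin G_def by (rule prod_sum_PiE) auto
  also have "\<dots> = (\<Sum>s\<in>G. monom (Poly_Mapping.single
          (\<Sum>i\<in>Poly_Mapping.keys a. Poly_Mapping.single i (Poly_Mapping.lookup a i + (p - 1) * s i))
          (of_nat (\<Prod>i\<in>Poly_Mapping.keys a. Poly_Mapping.lookup a i choose s i))) (\<Sum>i\<in>Poly_Mapping.keys a. s i))"
    by (simp add: prod_monom prod_single)
  finally have "coeff (total_mono p a) r = (\<Sum>s\<in>G. if (\<Sum>i\<in>Poly_Mapping.keys a. s i) = r then Poly_Mapping.single
          (\<Sum>i\<in>Poly_Mapping.keys a. Poly_Mapping.single i (Poly_Mapping.lookup a i + (p - 1) * s i))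
          (of_nat (\<Prod>i\<in>Poly_Mapping.keys a. Poly_Mapping.lookup a i choose s i) :: 'k) else 0)"
    by (simp only: coeff_sum coeff_monom)
  also have "\<dots> = (\<Sum>s\<in>{s\<in>G. (\<Sum>i\<in>Poly_Mapping.keys a. s i) = r}. Poly_Mapping.single
          (\<Sum>i\<in>Poly_Mapping.keys a. Poly_Mapping.single i (Poly_Mapping.lookup a i + (p - 1) * s i))
          (of_nat (\<Prod>i\<in>Poly_Mapping.keys a. Poly_Mapping.lookup a i choose s i) :: 'k))"
    by (intro sum.inter_filter[symmetric] fin)
  also have "\<dots> = steenrod_mono p r a"
    unfolding steenrod_mono_def
  \<comment> \<open>Choices in \<open>G\<close> are extensional functions on the keys of
    \<open>a\<close>. Extending them by 0 yields exactly the exponent vectors below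
    \<open>a\<close>, since those have no key outside.\<close>
  proof (rule sum.reindex_bij_witness[where
        i = "\<lambda>s. restrict (Poly_Mapping.lookup s) (Poly_Mapping.keys a)" and
        j = "\<lambda>s. Abs_poly_mapping (\<lambda>i. if i \<in> Poly_Mapping.keys a then s i else 0)"], goal_cases)
    case (1 s)
    thus ?case
      by (auto simp: G_def fun_eq_iff PiE_def extensional_def)
  next
    case (2 s)
    thus ?case
      by (auto simp: G_def)
  next
    case (3 s)
    then have "Poly_Mapping.lookup s i = 0" if "i \<notin> Poly_Mapping.keys a" for i
      using that by (auto simp: in_keys_iff) (metis le_zero_eq)
    thus ?case
      by (intro poly_mapping_eqI) auto
  next
    case (4 s)
    thus ?case
      by (auto simp: G_def)
  next
    case (5 s)
    let ?s = "Abs_poly_mapping (\<lambda>i. if i \<in> Poly_Mapping.keys a then s i else 0)"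
    have "(\<Sum>i\<in>Poly_Mapping.keys a. Poly_Mapping.single i (Poly_Mapping.lookup a i + (p - 1) * Poly_Mapping.lookup ?s i)) =
           a + Poly_Mapping.map (\<lambda>x. (p - 1) * x) ?s"
      by (rule sum_keys_single) (use 5 in \<open>auto simp: G_def PiE_def Pi_def\<close>)
    hence "(\<Sum>i\<in>Poly_Mapping.keys a. Poly_Mapping.single i (Poly_Mapping.lookup a i + (p - 1) * s i)) =
           a + Poly_Mapping.map (\<lambda>x. (p - 1) * x) ?s"
      by simp
    thus ?case by simp
  qed
  finally show ?thesis .
qed

lemma coeff_total_steenrod:
  assumes "p > 0"
  shows "coeff (total_steenrod p f) r = steenrod p r f"
  by (simp add: total_steenrod_def steenrod_def coeff_sum coeff_total_mono[OF assms])

lemma total_mono_superset: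
  assumes "finite A" "Poly_Mapping.keys a \<subseteq> A"
  shows "total_mono p a = (\<Prod>i\<in>A. [:yvar i, yvar i ^ p:] ^ Poly_Mapping.lookup a i)"
  unfolding total_mono_def using assms
  by (intro prod.mono_neutral_left) (auto simp: in_keys_iff)

lemma total_mono_add:
  "(total_mono p (a + b) :: 'k::comm_ring_1 mpol poly) = total_mono p a * total_mono p b"
proof -
  define A where "A = Poly_Mapping.keys a \<union> Poly_Mapping.keys b"
  have "(total_mono p c :: 'k mpol poly) =
      (\<Prod>i\<in>A. [:yvar i, yvar i ^ p:] ^ Poly_Mapping.lookup c i)" if "c \<in> {a, b, a + b}" for c
    by (rule total_mono_superset) (use that keys_add[of a b] in \<open>auto simp: A_def\<close>)
  from this[of a] this[of b] this[of "a + b"] show ?thesis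
    by (simp add: lookup_add power_add prod.distrib)
qed

lemma const_mpol_add: "const_mpol (a + b) = const_mpol a + const_mpol b"
  and const_mpol_mult: "const_mpol (a * b) = const_mpol a * const_mpol b"
  and const_mpol_0 [simp]: "const_mpol 0 = 0"
  and const_mpol_1 [simp]: "const_mpol 1 = 1"
  and const_mpol_minus: "const_mpol (- a) = - const_mpol a"
  by (simp_all add: const_mpol_def single_add mult_single single_uminus)

lemma const_mpol_power: "const_mpol (a ^ e) = const_mpol a ^ e"
  by (induction e) (simp_all add: const_mpol_mult)

lemma total_steenrod_add: "total_steenrod p (f + g) = total_steenrod p f + total_steenrod p g"
proof -
  have "(\<Sum>a\<in>Poly_Mapping.keys (f + g). [:const_mpol (Poly_Mapping.lookup (f + g) a):] * total_mono p a) =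
    (\<Sum>a\<in>Poly_Mapping.keys f. [:const_mpol (Poly_Mapping.lookup f a):] * total_mono p a) +
    (\<Sum>a\<in>Poly_Mapping.keys g. [:const_mpol (Poly_Mapping.lookup g a):] * total_mono p a)"
    by (rule setsum_keys_plus_distrib[where f = "\<lambda>a c. [:const_mpol c:] * total_mono p a"])
      (simp_all add: const_mpol_add smult_add_left)
  thus ?thesis by (simp only: total_steenrod_def)
qed

lemma total_steenrod_single:
  "total_steenrod p (Poly_Mapping.single a c) = [:const_mpol c:] * total_mono p a"
  by (cases "c = 0") (simp_all add: total_steenrod_def)

lemma total_steenrod_0 [simp]: "total_steenrod p 0 = 0"
  by (simp add: total_steenrod_def)

lemma total_steenrod_sum: "total_steenrod p (\<Sum>i\<in>A. f i) = (\<Sum>i\<in>A. total_steenrod p (f i))"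
  by (induction A rule: infinite_finite_induct) (simp_all add: total_steenrod_add)

lemma mpol_induct [case_names add single]:
  assumes "\<And>f g. P f \<Longrightarrow> P g \<Longrightarrow> P (f + g)" "\<And>a c. P (Poly_Mapping.single a c)"
  shows "P f"
proof (induction f rule: update_induct)
  case const
  show ?case using assms(2)[of undefined 0] by simp
next
  case (update f a b)
  have "Poly_Mapping.update a b f = f + Poly_Mapping.single a b"
    using update(1)
    by (intro poly_mapping_eqI)
      (auto simp: lookup_update lookup_add lookup_single when_def in_keys_iff)
  thus ?case using assms update by simp
qed

text \<open>The Cartan formula in all degrees at once. Both sides are biadditive, so two monomials
  suffice, where it is \<open>total_mono_add\<close>.\<close>

lemma total_steenrod_mult: "total_steenrod p (f * g) = total_steenrod p f * total_steenrod p g"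
proof (induction f rule: mpol_induct)
  case (single a c)
  show ?case
  proof (induction g rule: mpol_induct)
    case (single b d)
    show ?case
      by (simp add: mult_single total_steenrod_single total_mono_add const_mpol_mult mult_ac)
  qed (simp add: total_steenrod_add algebra_simps)
qed (simp add: total_steenrod_add algebra_simps)

lemma total_steenrod_const: "total_steenrod p (const_mpol c) = [:const_mpol c:]"
  unfolding const_mpol_def total_steenrod_single by (simp add: total_mono_def)

lemma total_steenrod_1 [simp]: "total_steenrod p 1 = 1"
  using total_steenrod_const[of p 1] by (simp add: one_pCons)

lemma total_steenrod_power: "total_steenrod p (f ^ e) = total_steenrod p f ^ e"
  by (induction e) (simp_all add: total_steenrod_mult)

lemma total_steenrod_minus: "total_steenrod p (- f) = - total_steenrod p f"
  using total_steenrod_add[of p f "- f"] by (simp add: eq_neg_iff_add_eq_0 add.commute)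

lemma total_steenrod_diff: "total_steenrod p (f - g) = total_steenrod p f - total_steenrod p g"
  using total_steenrod_add[of p f "- g"] by (simp add: total_steenrod_minus)

lemma total_steenrod_yvar: "total_steenrod p (yvar i) = [:yvar i, yvar i ^ p:]"
  by (subst (1) yvar_def) (simp add: total_steenrod_single total_mono_def)

section \<open>Products over a finite field\<close>

text \<open>Translation by 1 permutes the ring, so comparing the sum of all elements before and
  after gives p = 0 in it.\<close>

lemma CHAR_eq_prime_card:
  assumes "prime p" "card (UNIV :: 'a::{ring_1, zero_neq_one} set) = p"
  shows "CHAR('a) = p"
proof -
  have "(\<Sum>x\<in>UNIV. x) = (\<Sum>x\<in>UNIV. x + 1 :: 'a)"
    by (rule sum.reindex_bij_witness[of _ "\<lambda>x. x + 1" "\<lambda>x. x - 1"]) auto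
  hence "of_nat p = (0 :: 'a)"
    using assms(2) by (simp add: sum.distrib)
  hence "CHAR('a) dvd p" by (simp add: of_nat_eq_0_iff_char_dvd)
  moreover have "CHAR('a) \<noteq> 1" by simp
  ultimately show ?thesis using assms(1) by (auto simp: prime_nat_iff)
qed

lemma power_card_eq_same:
  fixes x :: "'a::field"
  assumes "finite (UNIV :: 'a set)"
  shows "x ^ card (UNIV :: 'a set) = x"
proof (cases "x = 0")
  case False
  have "(\<Prod>y\<in>UNIV - {0}. y) = (\<Prod>y\<in>UNIV - {0}. x * y)"
    by (rule prod.reindex_bij_witness[of _ "\<lambda>y. x * y" "\<lambda>y. y / x"]) (use False in auto)
  also have "\<dots> = x ^ card (UNIV - {0 :: 'a}) * (\<Prod>y\<in>UNIV - {0}. y)"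
    by (simp add: prod.distrib)
  finally have "x ^ card (UNIV - {0 :: 'a}) = 1"
    using assms by simp
  moreover have "card (UNIV :: 'a set) = Suc (card (UNIV - {0 :: 'a}))"
    by (rule card_Suc_Diff1[symmetric]) (use assms in auto)
  ultimately show ?thesis by (simp only: power_Suc mult_1_right)
qed (use assms in \<open>simp add: card_gt_0_iff\<close>)

text \<open>With q the order of the field, both sides are monic of degree q and vanish at all q
  elements.\<close>

lemma prod_linear_factors_field:
  assumes "finite (UNIV :: 'a::field set)"
  shows "(\<Prod>c\<in>UNIV. [:- c, 1 :: 'a:]) = monom 1 (card (UNIV :: 'a set)) - monom 1 1"
    (is "?P = ?Q")
proof -
  let ?q = "card (UNIV :: 'a set)"
  have q: "?q > 1"
    using assms card_mono[of "UNIV :: 'a set" "{0, 1}"] by simp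
  have deg: "degree ?P = ?q"
    by (subst degree_prod_eq_sum_degree) auto
  have "lead_coeff ?P = 1"
    by (simp add: lead_coeff_prod)
  hence lead: "coeff ?P ?q = coeff ?Q ?q"
    using q by (simp add: deg)
  have degQ: "degree ?Q \<le> ?q"
    using q by (intro degree_diff_le) (auto simp: degree_monom_eq)
  have roots: "poly ?P z = poly ?Q z" for z
  proof -
    have "(\<Prod>c\<in>UNIV. poly [:- c, 1:] z) = 0"
      by (rule prod_zero) (use assms in auto)
    thus ?thesis
      using power_card_eq_same[OF assms, of z] by (simp add: poly_prod poly_monom)
  qed
  show ?thesis
    using poly_eqI_degree_lead_coeff[OF lead order_refl _ degQ roots] deg by simp
qed

text \<open>\<open>Y\<close> may be a non-unit, so the homogeneous form cannot be obtained by
  substituting X/Y; it is built up one linear factor at a time instead.\<close>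

lemma prod_linear_homogenize:
  fixes h :: "'a::comm_ring_1 \<Rightarrow> 'b::comm_ring_1" and X Y :: 'b
  assumes h: "\<And>a b. h (a + b) = h a + h b" "\<And>a b. h (a * b) = h a * h b" "h 1 = 1"
    and "finite A"
  shows "(\<Prod>c\<in>A. X - h c * Y) =
    (\<Sum>i\<le>card A. h (coeff (\<Prod>c\<in>A. [:- c, 1:]) i) * X ^ i * Y ^ (card A - i))"
  using \<open>finite A\<close>
proof (induction A rule: finite_induct)
  case (insert c A)
  define g where "g = (\<Prod>c\<in>A. [:- c, 1:])"
  define d where "d = card A"
  define H where "H = (\<Sum>i\<le>d. h (coeff g i) * X ^ i * Y ^ (d - i))"
  have h0: "h 0 = 0" using h(1)[of 0 0] by simp
  have hm: "h (- a) = - h a" for a using h(1)[of a "- a"] h0 by (simp add: eq_neg_iff_add_eq_0 add.commute)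
  have "degree g \<le> sum (degree \<circ> (\<lambda>c. [:- c, 1:])) A"
    unfolding g_def by (rule degree_prod_sum_le) (use insert in simp)
  hence deg: "degree g \<le> d" by (simp add: d_def)
  \<comment> \<open>Removes the extra summand \<open>i = Suc d\<close>, the one index where
    \<open>Suc d - i\<close> differs from \<open>Suc (d - i)\<close>.\<close>
  have top: "coeff g (Suc d) = 0" by (rule coeff_eq_0) (use deg in simp)
  have g: "[:- c, 1:] * g = smult (- c) g + pCons 0 g" by simp
  have "(\<Sum>i\<le>Suc d. h (coeff ([:- c, 1:] * g) i) * X ^ i * Y ^ (Suc d - i)) =
      (\<Sum>i\<le>Suc d. - h c * h (coeff g i) * X ^ i * Y ^ (Suc d - i)) +
      (\<Sum>i\<le>Suc d. h (coeff (pCons 0 g) i) * X ^ i * Y ^ (Suc d - i))"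
    by (simp only: g coeff_add coeff_smult h hm sum.distrib[symmetric] distrib_right)
  also have "(\<Sum>i\<le>Suc d. - h c * h (coeff g i) * X ^ i * Y ^ (Suc d - i)) = - h c * Y * H"
    by (simp add: top h0 H_def sum_distrib_left Suc_diff_le mult_ac)
  also have "(\<Sum>i\<le>Suc d. h (coeff (pCons 0 g) i) * X ^ i * Y ^ (Suc d - i)) = X * H"
    by (subst sum.atMost_Suc_shift) (simp add: h0 H_def sum_distrib_left mult_ac)
  finally have "(\<Sum>i\<le>Suc d. h (coeff ([:- c, 1:] * g) i) * X ^ i * Y ^ (Suc d - i)) =
      (X - h c * Y) * H"
    by (simp only: left_diff_distrib) (simp add: mult_ac)
  moreover have "(\<Prod>c\<in>A. X - h c * Y) = H"
    unfolding H_def g_def d_def by (rule insert.IH)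
  ultimately show ?case
    by (simp only: prod.insert[OF insert.hyps] card_insert_disjoint[OF insert.hyps] g_def d_def)
qed (simp add: h)

text \<open>Drives the passage from rank n to n+1: there \<open>X\<close> is the Dickson polynomial
  of rank n and \<open>Y\<close> its value at the new variable.\<close>

lemma prod_finite_field_homogenize:
  fixes h :: "'a::field \<Rightarrow> 'b::comm_ring_1" and X Y :: 'b
  assumes "\<And>a b. h (a + b) = h a + h b" "\<And>a b. h (a * b) = h a * h b" "h 1 = 1"
    and fin: "finite (UNIV :: 'a set)" and q: "card (UNIV :: 'a set) = q"
  shows "(\<Prod>c\<in>UNIV. X - h c * Y) = X ^ q - Y ^ (q - 1) * X"
proof -
  have h0: "h 0 = 0" using assms(1)[of 0 0] by simp
  have hm: "h (- 1) = - 1" using assms(1)[of 1 "- 1"] h0 assms(3) by (simp add: eq_neg_iff_add_eq_0 add.commute)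
  have q1: "q > 1"
    using fin card_mono[of "UNIV :: 'a set" "{0, 1}"] q by simp
  have "(\<Prod>c\<in>UNIV. X - h c * Y) =
     (\<Sum>i\<le>q. h (coeff (monom 1 q - monom 1 1) i) * X ^ i * Y ^ (q - i))"
    using prod_linear_homogenize[of h "UNIV :: 'a set" X Y] assms
    by (simp only: prod_linear_factors_field fin q)
  also have "\<dots> = (\<Sum>i\<in>{q, 1}. h (coeff (monom 1 q - monom 1 1) i) * X ^ i * Y ^ (q - i))"
    using q1 by (intro sum.mono_neutral_right) (auto simp: h0 coeff_monom)
  also have "\<dots> = X ^ q - Y ^ (q - 1) * X"
    using q1 by (simp add: assms hm mult_ac)
  finally show ?thesis .
qed

section \<open>Coefficients of the Dickson polynomial\<close>

lemma CHAR_mpol [simp]: "CHAR('k::comm_ring_1 mpol) = CHAR('k)"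
proof (rule CHAR_eqI)
  show "of_nat CHAR('k) = (0 :: 'k mpol)"
    by (metis of_nat_CHAR single_of_nat single_zero)
next
  fix n
  assume "of_nat n = (0 :: 'k mpol)"
  hence "Poly_Mapping.single 0 (of_nat n :: 'k) = (0 :: 'k mpol)"
    by (simp only: single_of_nat)
  hence "of_nat n = (0 :: 'k)"
    by (metis lookup_single_eq lookup_zero)
  thus "CHAR('k) dvd n" by (simp add: of_nat_eq_0_iff_char_dvd)
qed

lemma freshmans_dream_diff:
  fixes x y :: "'a::comm_ring_1"
  assumes "prime CHAR('a)" "m = CHAR('a) ^ n"
  shows "(x - y) ^ m = x ^ m - y ^ m"
  using freshmans_dream'[OF assms, of "x - y" y] by (simp add: algebra_simps)

lemma const_poly_add: "[:a + b :: 'a::comm_monoid_add:] = [:a:] + [:b:]"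
  by simp

lemma const_poly_sum: "[:\<Sum>i\<in>A. f i:] = (\<Sum>i\<in>A. [:f i:])"
  by (induction A rule: infinite_finite_induct) (simp_all add: const_poly_add del: add_pCons)

text \<open>Effect on coefficient sequences of composing with Frobenius: the entry at X^(p^j) moves
  to X^(p^(j+1)), and nothing lands at index 0.\<close>

definition shift :: "(nat \<Rightarrow> 'a::zero) \<Rightarrow> nat \<Rightarrow> 'a" where
  "shift f k = (case k of 0 \<Rightarrow> 0 | Suc j \<Rightarrow> f j)"

lemma shift_simps [simp]: "shift f 0 = 0" "shift f (Suc j) = f j"
  by (simp_all add: shift_def)

text \<open>
  Adjoining \<open>y\<^sub>n\<^sub>+\<^sub>1\<close> turns the Dickson polynomial \<open>f\<close> of rank \<open>n\<close> into
  \<open>\<Prod>\<^sub>c f(X - c y\<^sub>n\<^sub>+\<^sub>1) = \<Prod>\<^sub>c (f - c w) = f^p - w^(p-1) f\<close> with \<open>w = f(y\<^sub>n\<^sub>+\<^sub>1)\<close>, because \<open>f\<close> is additive.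
\<close>

primrec dickson_coeff :: "nat \<Rightarrow> nat \<Rightarrow> nat \<Rightarrow> 'k::comm_ring_1 mpol" where
  "dickson_coeff p 0 = (\<lambda>k. if k = 0 then 1 else 0)"
| "dickson_coeff p (Suc n) = (\<lambda>k. shift (\<lambda>j. dickson_coeff p n j ^ p) k -
      (\<Sum>j\<le>n. dickson_coeff p n j * yvar (Suc n) ^ p ^ j) ^ (p - 1) * dickson_coeff p n k)"

lemma dickson_coeff_eq_0: "n < k \<Longrightarrow> p > 0 \<Longrightarrow> dickson_coeff p n k = 0"
  by (induction n arbitrary: k) (auto simp: shift_def power_0_left split: nat.splits)

lemma dickson_coeff_self: "p > 0 \<Longrightarrow> dickson_coeff p n n = 1"
  by (induction n) (auto simp: dickson_coeff_eq_0)

text \<open>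
  In the ring of additive polynomials (\<open>F\<close> the Frobenius \<open>X \<mapsto> X^p\<close>) the hypothesis \<open>E\<close> reads
  \<open>C \<circ> (1 + tF) = (a + t^(p^n) F) \<circ> c\<close>; it is inherited by \<open>c' = (F - w^(p-1)) \<circ> c\<close> and
  \<open>C' = (F - W^(p-1)) \<circ> C\<close>, with \<open>\<tau> j\<close> standing for \<open>t^(p^j)\<close>.
\<close>

lemma additive_commutation_step:
  fixes C c \<tau> :: "nat \<Rightarrow> 'a::comm_ring_1" and a w W :: 'a
  assumes char: "prime CHAR('a)" "CHAR('a) = p"
    and \<tau>: "\<And>j. \<tau> (Suc j) = \<tau> j ^ p"
    and E: "\<And>k. C k + shift (\<lambda>j. \<tau> j * C j) k = a * c k + \<tau> n * shift (\<lambda>j. c j ^ p) k"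
    and W: "W = a * w + \<tau> n * w ^ p"
    and c': "\<And>k. c' k = shift (\<lambda>j. c j ^ p) k - w ^ (p - 1) * c k"
    and C': "\<And>k. C' k = shift (\<lambda>j. C j ^ p) k - W ^ (p - 1) * C k"
  shows "\<exists>a'. \<forall>k. C' k + shift (\<lambda>j. \<tau> j * C' j) k = a' * c' k + \<tau> (Suc n) * shift (\<lambda>j. c' j ^ p) k"
proof -
  have p0: "p > 0" using char prime_gt_0_nat by simp
  have add: "(x + y) ^ p = x ^ p + y ^ p" for x y :: 'a
    by (rule freshmans_dream) (use char in simp_all)
  have diff: "(x - y) ^ p = x ^ p - y ^ p" for x y :: 'a
    using freshmans_dream_diff[OF char(1), of p 1 x y] char(2) by simp
  have split: "x ^ p = x * x ^ (p - 1)" for x :: 'a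
    using p0 by (cases p) simp_all
  \<comment> \<open>The new factor must satisfy (F - W^(p-1)) (a + t^(p^n) F) = (a' + t^(p^(n+1)) F)
    (F - w^(p-1)) under composition, where F x = x^p F. The terms in F^0 and F^1 give
    \<open>F1\<close> and \<open>F2\<close>; since \<open>W = w * u\<close>, the choice
    \<open>a' = a * u ^ (p - 1)\<close> solves both.\<close>
  define u where "u = a + \<tau> n * w ^ (p - 1)"
  define a' where "a' = a * u ^ (p - 1)"
  have W': "W = w * u" unfolding W u_def split[of w] by (simp add: algebra_simps)
  have F1: "W ^ (p - 1) * a = a' * w ^ (p - 1)"
    by (simp add: W' a'_def power_mult_distrib mult_ac)
  have "u ^ p = a ^ p + \<tau> n ^ p * (w ^ (p - 1)) ^ p"
    unfolding u_def add by (simp add: power_mult_distrib)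
  moreover have "u ^ p = a' + \<tau> n * W ^ (p - 1)"
    by (subst split, subst (1) u_def) (simp add: a'_def W' power_mult_distrib algebra_simps)
  ultimately have F2: "a ^ p = a' + \<tau> n * W ^ (p - 1) - \<tau> n ^ p * (w ^ (p - 1)) ^ p"
    by (simp add: algebra_simps)
  define e where "e k = a * c k + \<tau> n * shift (\<lambda>j. c j ^ p) k" for k
  have *: "C' k + shift (\<lambda>j. \<tau> j * C' j) k = a' * c' k + \<tau> (Suc n) * shift (\<lambda>j. c' j ^ p) k" for k
  proof (cases k)
    case 0
    have "C' 0 = - (W ^ (p - 1) * e 0)" using E[of 0] by (simp add: C' e_def)
    also have "\<dots> = - (W ^ (p - 1) * a * c 0)"
      by (simp add: e_def mult_ac)
    also have "\<dots> = a' * c' 0"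
      unfolding F1 by (simp add: c' mult_ac)
    finally show ?thesis by (simp add: 0)
  next
    case (Suc j)
    have sh: "\<tau> j * shift (\<lambda>j. f j ^ p) j = shift (\<lambda>j. \<tau> j * f j) j ^ p" for f
      using p0 by (cases j) (simp_all add: \<tau> power_mult_distrib power_0_left)
    have "C' k + shift (\<lambda>j. \<tau> j * C' j) k =
        C j ^ p - W ^ (p - 1) * C k + \<tau> j * (shift (\<lambda>j. C j ^ p) j - W ^ (p - 1) * C j)"
      by (simp add: C' Suc)
    also have "\<dots> = (C j + shift (\<lambda>j. \<tau> j * C j) j) ^ p - W ^ (p - 1) * (C k + shift (\<lambda>j. \<tau> j * C j) k)"
      unfolding add sh[symmetric] by (simp add: Suc algebra_simps)
    also have "\<dots> = (e j) ^ p - W ^ (p - 1) * e k"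
      by (simp only: E e_def)
    also have "\<dots> = a ^ p * c j ^ p + \<tau> n ^ p * shift (\<lambda>j. c j ^ p) j ^ p
        - (W ^ (p - 1) * a) * c k - W ^ (p - 1) * \<tau> n * c j ^ p"
      by (simp add: e_def add power_mult_distrib Suc algebra_simps)
    also have "\<dots> = a' * (c j ^ p - w ^ (p - 1) * c k)
        + \<tau> n ^ p * (shift (\<lambda>j. c j ^ p) j ^ p - (w ^ (p - 1)) ^ p * c j ^ p)"
      unfolding F1 F2 by (simp add: algebra_simps)
    also have "\<dots> = a' * c' k + \<tau> (Suc n) * shift (\<lambda>j. c' j ^ p) k"
      by (simp add: c' diff Suc \<tau> power_mult_distrib)
    finally show ?thesis .
  qed
  show ?thesis by (rule exI[of _ a'], rule allI, rule *)
qed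

locale fp_mpol =
  fixes p :: nat and field_type :: "'f::field itself"
  assumes prime: "prime p" and card_field: "card (UNIV :: 'f set) = p"
begin

lemma p_pos: "p > 0" and p_ge_2: "p \<ge> 2"
  using prime by (simp_all add: prime_gt_0_nat prime_ge_2_nat)

lemma finite_field: "finite (UNIV :: 'f set)"
  using card_field p_pos card_ge_0_finite by metis

lemma CHAR_field: "CHAR('f) = p"
  using CHAR_eq_prime_card[OF prime card_field] .

lemma frobenius_poly_add:
  fixes x y :: "'f mpol poly"
  shows "(x + y) ^ p ^ k = x ^ p ^ k + y ^ p ^ k"
  by (rule freshmans_dream'[of _ k]) (simp_all add: CHAR_field prime)

lemma frobenius_poly_diff:
  fixes x y :: "'f mpol poly"
  shows "(x - y) ^ p ^ k = x ^ p ^ k - y ^ p ^ k"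
  by (rule freshmans_dream_diff[of _ k]) (simp_all add: CHAR_field prime)

lemma frobenius_poly_sum:
  fixes f :: "'i \<Rightarrow> 'f mpol poly"
  shows "(\<Sum>i\<in>A. f i) ^ p = (\<Sum>i\<in>A. f i ^ p)"
  by (rule freshmans_dream_sum) (simp_all add: CHAR_field prime)

lemma power_p_power: "(c :: 'f) ^ p ^ k = c"
  using power_card_eq_same[OF finite_field]
  by (induction k) (simp_all add: card_field power_mult)

section \<open>Recursion of the Dickson polynomial in the rank\<close>

lemma lin_span_Suc:
  "lin_span (Suc n) = (\<lambda>(c, v). v + const_mpol c * yvar (Suc n)) ` (UNIV \<times> lin_span n :: ('f \<times> 'f mpol) set)"
proof (intro equalityI subsetI)
  fix v :: "'f mpol"
  assume "v \<in> lin_span (Suc n)"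
  then obtain c where "v = (\<Sum>i=1..Suc n. const_mpol (c i) * yvar i)"
    by (auto simp: lin_span_def)
  hence "v = (\<Sum>i=1..n. const_mpol (c i) * yvar i) + const_mpol (c (Suc n)) * yvar (Suc n)"
    by simp
  thus "v \<in> (\<lambda>(c, v). v + const_mpol c * yvar (Suc n)) ` (UNIV \<times> lin_span n)"
    by (auto simp: lin_span_def image_iff)
next
  fix v :: "'f mpol"
  assume "v \<in> (\<lambda>(c, v). v + const_mpol c * yvar (Suc n)) ` (UNIV \<times> lin_span n)"
  then obtain c d where v: "v = (\<Sum>i=1..n. const_mpol (c i) * yvar i) + const_mpol d * yvar (Suc n)"
    by (auto simp: lin_span_def)
  have "v = (\<Sum>i=1..Suc n. const_mpol ((c(Suc n := d)) i) * yvar i)"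
    by (auto simp: v intro!: sum.cong)
  thus "v \<in> lin_span (Suc n)" unfolding lin_span_def by blast
qed

text \<open>The scalar c can be read off as the coefficient at the new variable, which does not
  occur in \<open>lin_span n\<close>. Injectivity lets the product over the span become a double
  product.\<close>

lemma inj_lin_span_Suc:
  "inj_on (\<lambda>(c, v). v + const_mpol c * yvar (Suc n)) (UNIV \<times> lin_span n :: ('f \<times> 'f mpol) set)"
proof -
  let ?e = "Poly_Mapping.single (Suc n) (1 :: nat)"
  have y: "const_mpol c * yvar i = Poly_Mapping.single (Poly_Mapping.single i 1) (c :: 'f)" for c i
    by (simp add: const_mpol_def yvar_def mult_single)
  have ne: "Poly_Mapping.single i (1 :: nat) \<noteq> ?e" if "i \<le> n" for i
    using that by (metis Suc_n_not_le_n inj_single lookup_single_eq lookup_single_not_eq zero_neq_one)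
  have 0: "Poly_Mapping.lookup v ?e = 0" if "v \<in> lin_span n" for v :: "'f mpol"
    using that ne by (auto simp: lin_span_def y lookup_sum lookup_single_not_eq intro!: sum.neutral)
  have 1: "Poly_Mapping.lookup (v + const_mpol c * yvar (Suc n)) ?e = c" if "v \<in> lin_span n"
    for v :: "'f mpol" and c
    using 0[OF that] by (simp add: y lookup_add)
  show ?thesis
  proof (intro inj_onI, clarify)
    fix c d :: 'f and v w :: "'f mpol"
    assume *: "v \<in> lin_span n" "w \<in> lin_span n"
      "v + const_mpol c * yvar (Suc n) = w + const_mpol d * yvar (Suc n)"
    hence "c = d" using 1 by metis
    with * show "c = d \<and> v = w" by simp
  qed
qed

lemma dickson_poly_eq:
  "dickson_poly n = (\<Sum>k\<le>n. monom (dickson_coeff p n k :: 'f mpol) (p ^ k))"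
proof (induction n)
  case 0
  have "lin_span 0 = {0 :: 'f mpol}" by (auto simp: lin_span_def)
  thus ?case by (simp add: dickson_poly_def monom_altdef)
next
  case (Suc n)
  define F where "F = (dickson_poly n :: 'f mpol poly)"
  define y where "y = (yvar (Suc n) :: 'f mpol)"
  define w where "w = (\<Sum>k\<le>n. dickson_coeff p n k * y ^ p ^ k)"
  have F: "F = (\<Sum>k\<le>n. smult (dickson_coeff p n k) ([:0, 1:] ^ p ^ k))"
    unfolding F_def Suc by (simp add: monom_altdef)
  \<comment> \<open>\<open>F\<close> is additive and scalars are fixed by Frobenius, so F(X - c*y) =
    F(X) - c*F(y).\<close>
  have translate: "pcompose F [:- (const_mpol c * y), 1:] = F - [:const_mpol c:] * [:w:]" for c
  proof -
    have pow: "[:- (const_mpol c * y), 1:] ^ p ^ k = [:0, 1:] ^ p ^ k - [:const_mpol c * y ^ p ^ k:]" for k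
    proof -
      have "[:- (const_mpol c * y), 1:] = [:0, 1:] - [:const_mpol c * y:]" by simp
      thus ?thesis
        by (simp only: frobenius_poly_diff poly_const_pow power_mult_distrib
            const_mpol_power[symmetric] power_p_power)
    qed
    have X: "pcompose ([:0, 1:] ^ m) q = q ^ m" for m and q :: "'f mpol poly"
      by (induction m) (simp_all add: pcompose_mult pcompose_pCons pcompose_1)
    have "pcompose F [:- (const_mpol c * y), 1:] =
        (\<Sum>k\<le>n. smult (dickson_coeff p n k) ([:0, 1:] ^ p ^ k) - [:const_mpol c:] * [:dickson_coeff p n k * y ^ p ^ k:])"
      unfolding F pcompose_sum pcompose_smult X pow by (simp add: smult_diff_right mult_ac)
    also have "\<dots> = F - [:const_mpol c:] * [:w:]"
      unfolding F w_def by (simp only: sum_subtractf const_poly_sum sum_distrib_left)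
    finally show ?thesis .
  qed
  have "dickson_poly (Suc n) = (\<Prod>(c, v)\<in>UNIV \<times> lin_span n. [:- (v + const_mpol c * y), 1 :: 'f mpol:])"
    unfolding dickson_poly_def lin_span_Suc
    by (subst prod.reindex[OF inj_lin_span_Suc]) (simp add: case_prod_unfold y_def)
  also have "\<dots> = (\<Prod>c\<in>UNIV. \<Prod>v\<in>lin_span n. [:- (v + const_mpol c * y), 1 :: 'f mpol:])"
    by (rule prod.cartesian_product[symmetric])
  also have "\<dots> = (\<Prod>c\<in>UNIV. pcompose F [:- (const_mpol c * y), 1:])"
    by (simp add: F_def dickson_poly_def pcompose_prod pcompose_pCons)
  also have "\<dots> = (\<Prod>c\<in>UNIV. F - [:const_mpol c:] * [:w:])"
    by (simp only: translate)
  also have "\<dots> = F ^ p - [:w:] ^ (p - 1) * F"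
    by (rule prod_finite_field_homogenize) (simp_all add: const_mpol_add const_mpol_mult card_field finite_field one_pCons)
  also have "F ^ p = (\<Sum>k\<le>n. monom (dickson_coeff p n k ^ p) (p ^ Suc k))"
    unfolding F_def Suc frobenius_poly_sum by (simp add: monom_power mult.commute)
  also have "\<dots> = (\<Sum>k\<le>Suc n. monom (shift (\<lambda>j. dickson_coeff p n j ^ p) k) (p ^ k))"
    by (subst sum.atMost_Suc_shift) simp
  also have "[:w:] ^ (p - 1) * F = (\<Sum>k\<le>Suc n. monom (w ^ (p - 1) * dickson_coeff p n k) (p ^ k))"
    unfolding F_def Suc poly_const_pow sum_distrib_left
    by (simp add: dickson_coeff_eq_0 p_pos smult_monom)
  finally show ?case
    by (simp only: sum_subtractf[symmetric] diff_monom w_def y_def dickson_coeff.simps)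
qed

text \<open>The image of the Dickson polynomial f under the total operation, composed with X +
  t*X^p, vanishes on the span and so should factor through f; the equation is this factorization. It
  is proved by induction on the rank, since the coefficients and their images obey the same
  recursion.\<close>

lemma total_dickson_coeff:
  "\<exists>a. \<forall>k. total_steenrod p (dickson_coeff p n k :: 'f mpol) +
      shift (\<lambda>j. monom 1 (p ^ j) * total_steenrod p (dickson_coeff p n j)) k =
    a * [:dickson_coeff p n k:] + monom 1 (p ^ n) * shift (\<lambda>j. [:dickson_coeff p n j:] ^ p) k"
proof (induction n)
  case 0
  have "total_steenrod p (dickson_coeff p 0 k :: 'f mpol) +
      shift (\<lambda>j. monom 1 (p ^ j) * total_steenrod p (dickson_coeff p 0 j)) k =
    1 * [:dickson_coeff p 0 k:] + monom 1 (p ^ 0) * shift (\<lambda>j. [:dickson_coeff p 0 j:] ^ p) k" for k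
  proof (cases k)
    case (Suc j)
    thus ?thesis by (cases j) (simp_all add: p_pos one_pCons poly_const_pow)
  qed (simp add: one_pCons)
  thus ?case by blast
next
  case (Suc n)
  let ?c = "\<lambda>k. dickson_coeff p n k :: 'f mpol"
  let ?\<tau> = "\<lambda>j. monom 1 (p ^ j) :: 'f mpol poly"
  define y where "y = (yvar (Suc n) :: 'f mpol)"
  define w where "w = (\<Sum>k\<le>n. ?c k * y ^ p ^ k)"
  from Suc obtain a where a: "\<And>k. total_steenrod p (?c k) + shift (\<lambda>j. ?\<tau> j * total_steenrod p (?c j)) k =
    a * [:?c k:] + ?\<tau> n * shift (\<lambda>j. [:?c j:] ^ p) k" by blast
  have pow: "total_steenrod p y ^ p ^ k = [:y ^ p ^ k:] + ?\<tau> k * [:y ^ p ^ Suc k:]" for k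
  proof -
    have "total_steenrod p y = [:y:] + monom (y ^ p) 1"
      by (simp add: y_def total_steenrod_yvar monom_altdef)
    hence "total_steenrod p y ^ p ^ k = [:y:] ^ p ^ k + monom (y ^ p) 1 ^ p ^ k"
      by (simp only: frobenius_poly_add)
    thus ?thesis
      by (simp add: poly_const_pow monom_power smult_monom power_mult mult.commute[of "monom _ _"])
  qed
  \<comment> \<open>Evaluates the induction hypothesis at the new variable y, whose image is y +
    t*y^p, in order to relate the image of \<open>w\<close> to \<open>w\<close> itself.\<close>
  have "total_steenrod p w = (\<Sum>k\<le>n. total_steenrod p (?c k) * [:y ^ p ^ k:]) +
      (\<Sum>k\<le>n. ?\<tau> k * total_steenrod p (?c k) * [:y ^ p ^ Suc k:])"
    unfolding w_def
    by (simp only: total_steenrod_sum total_steenrod_mult total_steenrod_power pow sum.distrib[symmetric])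
      (simp add: algebra_simps)
  also have "(\<Sum>k\<le>n. total_steenrod p (?c k) * [:y ^ p ^ k:]) =
      (\<Sum>k\<le>Suc n. total_steenrod p (?c k) * [:y ^ p ^ k:])"
    by (simp add: dickson_coeff_eq_0 p_pos)
  also have "(\<Sum>k\<le>n. ?\<tau> k * total_steenrod p (?c k) * [:y ^ p ^ Suc k:]) =
      (\<Sum>k\<le>Suc n. shift (\<lambda>j. ?\<tau> j * total_steenrod p (?c j)) k * [:y ^ p ^ k:])"
    by (subst sum.atMost_Suc_shift) simp
  also have "(\<Sum>k\<le>Suc n. total_steenrod p (?c k) * [:y ^ p ^ k:]) + \<dots> =
      (\<Sum>k\<le>Suc n. (a * [:?c k:] + ?\<tau> n * shift (\<lambda>j. [:?c j:] ^ p) k) * [:y ^ p ^ k:])"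
    by (simp only: sum.distrib[symmetric] distrib_right[symmetric] a)
  also have "\<dots> = a * (\<Sum>k\<le>Suc n. [:?c k:] * [:y ^ p ^ k:]) +
      ?\<tau> n * (\<Sum>k\<le>Suc n. shift (\<lambda>j. [:?c j:] ^ p) k * [:y ^ p ^ k:])"
    by (simp only: distrib_right sum.distrib sum_distrib_left mult.assoc)
  also have "(\<Sum>k\<le>Suc n. [:?c k:] * [:y ^ p ^ k:]) = [:w:]"
    by (simp add: w_def const_poly_sum dickson_coeff_eq_0 p_pos mult_ac)
  also have "(\<Sum>k\<le>Suc n. shift (\<lambda>j. [:?c j:] ^ p) k * [:y ^ p ^ k:]) = [:w:] ^ p"
    unfolding w_def const_poly_sum frobenius_poly_sum
    by (subst sum.atMost_Suc_shift)
      (simp add: poly_const_pow power_mult_distrib power_mult[symmetric] mult_ac)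
  finally have W: "total_steenrod p w = a * [:w:] + ?\<tau> n * [:w:] ^ p" .
  show ?case
  proof (rule additive_commutation_step[where w = "[:w:]" and W = "total_steenrod p w" and a = a and n = n
        and c = "\<lambda>k. [:?c k:]" and C = "\<lambda>k. total_steenrod p (?c k)"])
    show "prime CHAR('f mpol poly)" "CHAR('f mpol poly) = p" by (simp_all add: CHAR_field prime)
    show "?\<tau> (Suc j) = ?\<tau> j ^ p" for j by (simp add: monom_power mult.commute)
    have 1: "dickson_coeff p (Suc n) k = shift (\<lambda>j. ?c j ^ p) k - w ^ (p - 1) * ?c k" for k
      by (simp add: w_def y_def)
    show "[:dickson_coeff p (Suc n) k:] = shift (\<lambda>j. [:?c j:] ^ p) k - [:w:] ^ (p - 1) * [:?c k:]" for k
      unfolding 1 by (cases k) (simp_all add: poly_const_pow)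
    show "total_steenrod p (dickson_coeff p (Suc n) k) =
        shift (\<lambda>j. total_steenrod p (?c j) ^ p) k - total_steenrod p w ^ (p - 1) * total_steenrod p (?c k)" for k
      unfolding 1
      by (cases k) (simp_all add: total_steenrod_diff total_steenrod_minus total_steenrod_mult total_steenrod_power)
  qed (fact a W)+
qed

section \<open>Steenrod operations on Dickson coefficients\<close>

lemma steenrod_eq_coeff: "steenrod p r (f :: 'f mpol) = coeff (total_steenrod p f) r"
  by (simp add: coeff_total_steenrod p_pos)

lemma steenrod_add: "steenrod p r (f + g :: 'f mpol) = steenrod p r f + steenrod p r g"
  by (simp add: steenrod_eq_coeff total_steenrod_add)

lemma steenrod_const_mult: "steenrod p r (const_mpol u * f :: 'f mpol) = const_mpol u * steenrod p r f"
  by (simp add: steenrod_eq_coeff total_steenrod_mult total_steenrod_const)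

lemma steenrod_0: "steenrod p 0 (f :: 'f mpol) = f"
proof (induction f rule: mpol_induct)
  case (single a c)
  have "coeff (total_mono p a :: 'f mpol poly) 0 = (\<Prod>i\<in>Poly_Mapping.keys a. yvar i ^ Poly_Mapping.lookup a i)"
    by (simp add: total_mono_def poly_prod flip: poly_0_coeff_0)
  also have "\<dots> = Poly_Mapping.single (\<Sum>i\<in>Poly_Mapping.keys a. Poly_Mapping.single i (Poly_Mapping.lookup a i)) 1"
    by (simp add: yvar_power prod_single)
  also have "(\<Sum>i\<in>Poly_Mapping.keys a. Poly_Mapping.single i (Poly_Mapping.lookup a i)) = a"
    using sum_keys_single[of 0 a 0] by (simp add: Poly_Mapping.map_eq_zero_iff)
  finally show ?case
    by (simp add: steenrod_eq_coeff total_steenrod_single const_mpol_def mult_single)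
qed (simp add: steenrod_add)

lemma steenrod_mult:
  "steenrod p r (f * g :: 'f mpol) = (\<Sum>i\<le>r. steenrod p i f * steenrod p (r - i) g)"
  by (simp add: steenrod_eq_coeff total_steenrod_mult coeff_mult)

text \<open>In characteristic p the p-th power is taken term by term, on coefficients and exponents
  alike.\<close>

lemma coeff_power_p:
  fixes G :: "'f mpol poly"
  shows "coeff (G ^ p) r = (if p dvd r then coeff G (r div p) ^ p else 0)"
proof -
  have "G ^ p = (\<Sum>i\<le>degree G. monom (coeff G i ^ p) (i * p))"
    by (subst poly_as_sum_of_monoms[symmetric]) (simp add: frobenius_poly_sum monom_power)
  hence *: "coeff (G ^ p) r = (\<Sum>i\<le>degree G. if i * p = r then coeff G i ^ p else 0)"
    by (simp add: coeff_sum)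
  show ?thesis
  proof (cases "p dvd r")
    case True
    then obtain s where r: "r = s * p" by (metis dvd_def mult.commute)
    have "coeff (G ^ p) r = (\<Sum>i\<le>degree G. if i = s then coeff G i ^ p else 0)"
      unfolding * using p_pos by (simp add: r)
    also have "\<dots> = coeff G s ^ p"
      using p_pos by (auto simp: coeff_eq_0 power_0_left)
    finally show ?thesis using p_pos by (simp add: r)
  next
    case False
    thus ?thesis unfolding * by (auto intro!: sum.neutral)
  qed
qed

lemma steenrod_power_p:
  "steenrod p r (g ^ p :: 'f mpol) = (if p dvd r then steenrod p (r div p) g ^ p else 0)"
  by (simp add: steenrod_eq_coeff total_steenrod_power coeff_power_p)

text \<open>With m = n - 1, the relation of \<open>total_dickson_coeff\<close> at index n determines
  its multiplier: a = 1 + c_m t^(p^m) + higher terms. The relations at smaller indices are then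
  compared in low powers of t.\<close>

lemma steenrod_dickson_coeff:
  fixes n :: nat
  defines "c \<equiv> dickson_coeff p n :: nat \<Rightarrow> 'f mpol"
  assumes n: "n > 0"
  shows steenrod_dickson_coeff_0_eq_0: "\<And>r. 0 < r \<Longrightarrow> r < p ^ (n - 1) \<Longrightarrow> steenrod p r (c 0) = 0"
    and steenrod_dickson_coeff_0: "steenrod p (p ^ (n - 1)) (c 0) = c (n - 1) * c 0"
    and steenrod_dickson_coeff_Suc_eq_0:
      "\<And>r k. Suc k < n \<Longrightarrow> 0 < r \<Longrightarrow> r < p ^ k \<Longrightarrow> steenrod p r (c (Suc k)) = 0"
    and steenrod_dickson_coeff_Suc: "\<And>k. Suc k < n \<Longrightarrow> steenrod p (p ^ k) (c (Suc k)) = - c k"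
proof -
  define T where "T k = total_steenrod p (c k)" for k
  obtain a where a: "\<And>k. T k + shift (\<lambda>j. monom 1 (p ^ j) * T j) k =
      a * [:c k:] + monom 1 (p ^ n) * shift (\<lambda>j. [:c j:] ^ p) k"
    using total_dickson_coeff[of n] unfolding T_def c_def by blast
  obtain m where m: "n = Suc m" using n by (cases n) auto
  have p1: "p > 1" using p_ge_2 by simp
  have lt: "p ^ i < p ^ j" if "i < j" for i j
    using p1 that by simp
  have T0: "coeff (T k) 0 = c k" for k
    using steenrod_0[of "c k"] by (simp add: T_def steenrod_eq_coeff)
  have "1 + monom 1 (p ^ m) * T m = a + monom 1 (p ^ n) * [:c m:] ^ p"
    using a[of n] by (simp add: m T_def c_def dickson_coeff_self p_pos one_pCons[symmetric] del: dickson_coeff.simps)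
  hence A: "a = 1 + monom 1 (p ^ m) * T m - monom 1 (p ^ n) * [:c m:] ^ p"
    by (simp add: algebra_simps)
  have a0: "coeff a r = 0" if "0 < r" "r < p ^ m" for r
    using that less_trans[OF that(2) lt[of m n]] m by (simp add: A coeff_monom_mult del: power_Suc)
  have am: "coeff a (p ^ m) = c m"
    using lt[of m n] p_pos by (simp add: A coeff_monom_mult m T0)
  have S0: "steenrod p r (c 0) = coeff a r * c 0" for r
    using a[of 0] by (simp add: steenrod_eq_coeff T_def mult.commute)
  have SS: "steenrod p r (c (Suc k)) =
      coeff a r * c (Suc k) - (if r < p ^ k then 0 else coeff (T k) (r - p ^ k))"
    if "Suc k < n" "r \<le> p ^ k" for r k
  proof -
    have "r < p ^ n" using that lt[of k n] by simp
    moreover have "T (Suc k) = a * [:c (Suc k):] + monom 1 (p ^ n) * [:c k:] ^ p - monom 1 (p ^ k) * T k"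
      using a[of "Suc k"] by (simp add: algebra_simps)
    ultimately show ?thesis
      by (simp add: steenrod_eq_coeff T_def[symmetric] coeff_monom_mult mult.commute[of "coeff a r"])
  qed
  show "steenrod p r (c 0) = 0" if "0 < r" "r < p ^ (n - 1)" for r
    using that by (simp add: S0 a0 m)
  show "steenrod p (p ^ (n - 1)) (c 0) = c (n - 1) * c 0"
    by (simp add: S0 am m)
  show "steenrod p r (c (Suc k)) = 0" if "Suc k < n" "0 < r" "r < p ^ k" for r k
    using that lt[of k m] by (simp add: SS a0 m)
  show "steenrod p (p ^ k) (c (Suc k)) = - c k" if "Suc k < n" for k
    using that lt[of k m] p_pos by (simp add: SS a0 m T0)
qed

text \<open>An element of level j behaves as a scalar for the operations below degree p^j, and
  P^(p^j) obeys the Leibniz rule on products with it.\<close>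

definition level :: "nat \<Rightarrow> 'f mpol \<Rightarrow> bool" where
  "level j f \<longleftrightarrow> (\<forall>r. 0 < r \<longrightarrow> r < p ^ j \<longrightarrow> steenrod p r f = 0)"

lemma level_mono: "level j f \<Longrightarrow> i \<le> j \<Longrightarrow> level i f"
  unfolding level_def using power_increasing[of i j p] p_pos by fastforce

lemma steenrod_level_mult:
  assumes "level j f" "r < p ^ j"
  shows "steenrod p r (f * g) = f * steenrod p r g"
proof -
  have "steenrod p r (f * g) = (\<Sum>i\<in>{0}. steenrod p i f * steenrod p (r - i) g)"
    unfolding steenrod_mult using assms by (intro sum.mono_neutral_right) (auto simp: level_def)
  thus ?thesis by (simp add: steenrod_0)
qed

lemma steenrod_level_Leibniz:
  assumes "level j f"
  shows "steenrod p (p ^ j) (f * g) = f * steenrod p (p ^ j) g + steenrod p (p ^ j) f * g"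
proof -
  have "steenrod p (p ^ j) (f * g) = (\<Sum>i\<in>{0, p ^ j}. steenrod p i f * steenrod p (p ^ j - i) g)"
    unfolding steenrod_mult using assms
    by (intro sum.mono_neutral_right) (auto simp: level_def)
  thus ?thesis using p_pos by (simp add: steenrod_0)
qed

lemma level_mult: "level j f \<Longrightarrow> level j g \<Longrightarrow> level j (f * g)"
  unfolding level_def[of j "f * g"] by (auto simp: steenrod_level_mult[of j f]) (auto simp: level_def)

lemma level_const: "level j (const_mpol u)"
  by (auto simp: level_def steenrod_eq_coeff total_steenrod_const coeff_pCons split: nat.splits)

lemma level_1: "level j 1"
  using level_const[of j 1] by simp

lemma level_power: "level j f \<Longrightarrow> level j (f ^ e)"
  by (induction e) (simp_all add: level_1 level_mult)

lemma level_prod: "(\<And>i. i \<in> A \<Longrightarrow> level j (f i)) \<Longrightarrow> level j (\<Prod>i\<in>A. f i)"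
  by (induction A rule: infinite_finite_induct) (simp_all add: level_1 level_mult)

text \<open>The power rule for a derivation. At \<open>e = 0\<close> the truncated exponent is
  harmless because the scalar vanishes.\<close>

lemma steenrod_level_power:
  assumes "level j f"
  shows "steenrod p (p ^ j) (f ^ e) = const_mpol (of_nat e) * f ^ (e - 1) * steenrod p (p ^ j) f"
proof (induction e)
  case 0
  show ?case using p_pos by (simp add: steenrod_eq_coeff)
next
  case (Suc e)
  have "steenrod p (p ^ j) (f ^ Suc e) =
      const_mpol (of_nat e) * (f * f ^ (e - 1)) * steenrod p (p ^ j) f + f ^ e * steenrod p (p ^ j) f"
    by (simp add: steenrod_level_Leibniz[OF assms] Suc mult_ac)
  also have "\<dots> = const_mpol (of_nat (Suc e)) * f ^ e * steenrod p (p ^ j) f"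
  proof -
    have "const_mpol (of_nat (Suc e)) = (1 + const_mpol (of_nat e) :: 'f mpol)"
      by (simp add: const_mpol_add)
    moreover have "const_mpol (of_nat e) * (f * f ^ (e - 1)) = const_mpol (of_nat e) * f ^ e"
      by (cases e) simp_all
    ultimately show ?thesis by (simp only: distrib_right mult_1_left add.commute)
  qed
  finally show ?case by simp
qed

lemma level_dickson_coeff:
  assumes "i < k \<and> k < n \<or> k = 0 \<and> i < n"
  shows "level i (dickson_coeff p n k)"
proof (cases k)
  case 0
  have "level (n - 1) (dickson_coeff p n 0)"
    using steenrod_dickson_coeff_0_eq_0[of n] assms unfolding level_def by auto
  thus ?thesis using 0 assms by (auto intro: level_mono)
next
  case (Suc l)
  have "level l (dickson_coeff p n k)"
    using steenrod_dickson_coeff_Suc_eq_0[of n l] Suc assms unfolding level_def by auto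
  thus ?thesis using Suc assms by (auto intro: level_mono)
qed

text \<open>\<open>steenrod_comp\<close> folds from the right, so P^(p^(j-1)) acts first and P^1
  last.\<close>

definition cascade :: "nat \<Rightarrow> 'f mpol \<Rightarrow> 'f mpol" where
  "cascade j = steenrod_comp p (map (\<lambda>i. p ^ i) [0..<j])"

lemma cascade_0: "cascade 0 f = f"
  and cascade_Suc: "cascade (Suc j) f = cascade j (steenrod p (p ^ j) f)"
  by (simp_all add: cascade_def steenrod_comp_def)

lemma cascade_add: "cascade j (f + g) = cascade j f + cascade j g"
  by (induction j arbitrary: f g) (simp_all add: cascade_0 cascade_Suc steenrod_add)

lemma cascade_level_mult: "level j h \<Longrightarrow> cascade j (h * f) = h * cascade j f"
proof (induction j arbitrary: f)
  case (Suc j)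
  have "p ^ j < p ^ Suc j" using p_ge_2 by (intro power_strict_increasing) auto
  thus ?case
    using Suc level_mono[OF Suc.prems, of j] by (simp add: cascade_Suc steenrod_level_mult[OF Suc.prems])
qed (simp add: cascade_0)

text \<open>Each P^(p^(i+1)) turns a p-th power into another p-th power, so P^1 finally meets one
  and kills it. At least one operation is required, hence \<open>Suc j\<close>.\<close>

lemma cascade_power_p: "cascade (Suc j) (g ^ p) = 0"
proof (induction j arbitrary: g)
  case 0
  show ?case using p_ge_2 by (simp add: cascade_0 cascade_Suc steenrod_power_p)
next
  case (Suc j)
  have "steenrod p (p ^ Suc j) (g ^ p) = steenrod p (p ^ j) g ^ p"
    using p_pos by (simp add: steenrod_power_p)
  thus ?case using Suc by (simp add: cascade_Suc[of "Suc j"])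
qed

text \<open>By Leibniz the first operation hits either \<open>f\<close> or \<open>g ^ p\<close>. The
  second summand vanishes: immediately for j = 0, and otherwise because it is a factor of level j
  times a p-th power, which the remaining cascade kills.\<close>

lemma cascade_Suc_level:
  assumes h: "level (Suc j) h" and f: "level j f"
  shows "cascade (Suc j) (h * f * g ^ p) = cascade j (h * steenrod p (p ^ j) f * g ^ p)"
proof -
  have "p ^ j < p ^ Suc j" using p_ge_2 by (intro power_strict_increasing) auto
  hence "steenrod p (p ^ j) (h * (f * g ^ p)) =
      h * (f * steenrod p (p ^ j) (g ^ p) + steenrod p (p ^ j) f * g ^ p)"
    using h f by (simp add: steenrod_level_mult steenrod_level_Leibniz)
  moreover have "cascade j ((h * f) * steenrod p (p ^ j) (g ^ p)) = 0"
  proof (cases j)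
    case 0
    show ?thesis using p_ge_2 by (simp add: 0 cascade_0 steenrod_power_p)
  next
    case (Suc i)
    have "steenrod p (p ^ j) (g ^ p) = steenrod p (p ^ i) g ^ p"
      using p_pos Suc by (simp add: steenrod_power_p)
    moreover have "level j (h * f)"
      using level_mult level_mono[OF h, of j] f by simp
    ultimately show ?thesis
      by (simp add: cascade_level_mult cascade_power_p Suc)
  qed
  ultimately show ?thesis
    by (simp add: cascade_Suc cascade_add distrib_left mult.assoc)
qed

text \<open>The successive operations move c_i to -c_(i-1), then to c_(i-2), and so on down to c_0;
  the signs are absorbed into \<open>h\<close>, which is arbitrary in the induction.\<close>

lemma cascade_dickson_coeff:
  assumes "i < n" "level i h"
  shows "cascade i (h * dickson_coeff p n i * g ^ p) =
    const_mpol ((-1) ^ i) * h * dickson_coeff p n 0 * g ^ p"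
  using assms
proof (induction i arbitrary: h)
  case (Suc i)
  have "cascade (Suc i) (h * dickson_coeff p n (Suc i) * g ^ p) =
      cascade i (h * steenrod p (p ^ i) (dickson_coeff p n (Suc i)) * g ^ p)"
    using Suc.prems by (intro cascade_Suc_level level_dickson_coeff) auto
  also have "\<dots> = cascade i ((const_mpol (-1) * h) * dickson_coeff p n i * g ^ p)"
    using Suc.prems steenrod_dickson_coeff_Suc[of n i] by (simp add: const_mpol_minus)
  also have "\<dots> = const_mpol ((-1) ^ i) * (const_mpol (-1) * h) * dickson_coeff p n 0 * g ^ p"
    using Suc.prems by (intro Suc.IH level_mult level_const) (auto intro: level_mono)
  finally show ?case by (simp add: const_mpol_mult[symmetric] mult.assoc[symmetric])
qed (simp add: cascade_0)

text \<open>The first operation differentiates the power to -e*c_i^(e-1)*c_(i-1). The remaining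
  c_i^(e-1) has level i-1, so it joins \<open>h\<close> while c_(i-1) descends to c_0.\<close>

lemma cascade_dickson_coeff_power:
  assumes "0 < i" "i < n" "level i h"
  shows "cascade i (h * dickson_coeff p n i ^ e * g ^ p) =
    const_mpol ((-1) ^ i * of_nat e) * (h * dickson_coeff p n i ^ (e - 1) * dickson_coeff p n 0 * g ^ p)"
proof -
  obtain j where i: "i = Suc j" using assms by (cases i) auto
  let ?c = "dickson_coeff p n :: nat \<Rightarrow> 'f mpol"
  have lev: "level j (?c i)" using assms i by (intro level_dickson_coeff) auto
  have "cascade i (h * ?c i ^ e * g ^ p) = cascade j (h * steenrod p (p ^ j) (?c i ^ e) * g ^ p)"
    unfolding i using assms lev by (intro cascade_Suc_level level_power) (auto simp: i)
  also have "steenrod p (p ^ j) (?c i ^ e) = const_mpol (of_nat e) * ?c i ^ (e - 1) * - ?c j"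
    using steenrod_level_power[OF lev, of e] steenrod_dickson_coeff_Suc[of n j] assms i by simp
  also have "h * \<dots> * g ^ p = (const_mpol (- of_nat e) * h * ?c i ^ (e - 1)) * ?c j * g ^ p"
    by (simp add: const_mpol_minus mult_ac)
  also have "cascade j \<dots> = const_mpol ((-1) ^ j) * (const_mpol (- of_nat e) * h * ?c i ^ (e - 1)) * ?c 0 * g ^ p"
    using assms lev i
    by (intro cascade_dickson_coeff level_mult level_const level_power) (auto intro: level_mono)
  finally show ?thesis by (simp add: i const_mpol_mult const_mpol_minus mult_ac)
qed

text \<open>Here the first operation is P^(p^(n-1)), which produces e*c_0^e*c_(n-1); then c_(n-1)
  descends to the additional factor c_0.\<close>

lemma cascade_dickson_coeff_0_power:
  assumes "0 < n"
  shows "cascade n (dickson_coeff p n 0 ^ e * g ^ p) =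
    const_mpol ((-1) ^ (n - 1) * of_nat e) * (dickson_coeff p n 0 ^ Suc e * g ^ p)"
\<comment> \<open>Merging c_0^(e-1)*c_0 into c_0^e needs e > 0; for e = 0 both sides vanish.\<close>
proof (cases "e = 0")
  case True
  obtain m where "n = Suc m" using assms by (cases n) auto
  thus ?thesis using True by (simp add: cascade_power_p)
next
  case False
  obtain m where n: "n = Suc m" using assms by (cases n) auto
  let ?c = "dickson_coeff p n :: nat \<Rightarrow> 'f mpol"
  have lev: "level m (?c 0)" using n by (intro level_dickson_coeff) auto
  have "cascade n (1 * ?c 0 ^ e * g ^ p) = cascade m (1 * steenrod p (p ^ m) (?c 0 ^ e) * g ^ p)"
    unfolding n by (intro cascade_Suc_level level_power level_1) (use lev n in auto)
  also have "steenrod p (p ^ m) (?c 0 ^ e) = const_mpol (of_nat e) * ?c 0 ^ (e - 1) * (?c m * ?c 0)"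
    using steenrod_level_power[OF lev, of e] steenrod_dickson_coeff_0[of n] n by simp
  also have "1 * \<dots> * g ^ p = (const_mpol (of_nat e) * ?c 0 ^ e) * ?c m * g ^ p"
    using False by (cases e) (simp_all add: mult_ac del: dickson_coeff.simps)
  also have "cascade m \<dots> = const_mpol ((-1) ^ m) * (const_mpol (of_nat e) * ?c 0 ^ e) * ?c 0 * g ^ p"
    using lev n by (intro cascade_dickson_coeff level_mult level_const level_power) auto
  finally show ?thesis by (simp add: n const_mpol_mult mult_ac del: dickson_coeff.simps)
qed

section \<open>Monomials in the Dickson coefficients\<close>

text \<open>Nonzero scalars are ignored; operations are linear over them, which makes the relation
  transitive.\<close>

definition reaches :: "'f mpol \<Rightarrow> 'f mpol \<Rightarrow> bool" where
  "reaches f g \<longleftrightarrow> (\<exists>rs u. u \<noteq> 0 \<and> steenrod_comp p rs f = const_mpol u * g)"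

lemma steenrod_comp_const_mult:
  "steenrod_comp p rs (const_mpol u * f :: 'f mpol) = const_mpol u * steenrod_comp p rs f"
  by (induction rs) (simp_all add: steenrod_comp_def steenrod_const_mult)

lemma reaches_refl: "reaches f f"
  unfolding reaches_def by (intro exI[of _ "[]"] exI[of _ 1]) (simp add: steenrod_comp_def)

lemma reaches_trans [trans]:
  assumes "reaches f g" "reaches g h"
  shows "reaches f h"
proof -
  obtain rs u where 1: "u \<noteq> 0" "steenrod_comp p rs f = const_mpol u * g"
    using assms(1) unfolding reaches_def by blast
  obtain rs' u' where 2: "u' \<noteq> 0" "steenrod_comp p rs' g = const_mpol u' * h"
    using assms(2) unfolding reaches_def by blast
  have "steenrod_comp p (rs' @ rs) f = steenrod_comp p rs' (steenrod_comp p rs f)"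
    by (simp add: steenrod_comp_def)
  hence "steenrod_comp p (rs' @ rs) f = const_mpol (u * u') * h"
    by (simp only: 1 2 steenrod_comp_const_mult const_mpol_mult mult.assoc)
  thus ?thesis unfolding reaches_def using 1 2 by (metis mult_eq_0_iff)
qed

text \<open>Multiplying every index of the composite by p makes it act on p-th powers as the
  original acts on the roots.\<close>

lemma reaches_power_p:
  assumes "reaches f g"
  shows "reaches (f ^ p) (g ^ p)"
proof -
  obtain rs u where 1: "u \<noteq> 0" "steenrod_comp p rs f = const_mpol u * g"
    using assms unfolding reaches_def by blast
  have "steenrod_comp p (map ((*) p) rs) (f ^ p) = steenrod_comp p rs f ^ p"
    using p_pos by (induction rs) (simp_all add: steenrod_comp_def steenrod_power_p)
  also have "\<dots> = const_mpol (u ^ p) * g ^ p"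
    by (simp add: 1 power_mult_distrib const_mpol_power)
  finally show ?thesis unfolding reaches_def using 1 by (metis power_not_zero)
qed

lemma reaches_cascade:
  "cascade j f = const_mpol u * g \<Longrightarrow> u \<noteq> 0 \<Longrightarrow> reaches f g"
  unfolding reaches_def cascade_def by blast

lemma of_nat_field_neq_0: "\<not> p dvd e \<Longrightarrow> (of_nat e :: 'f) \<noteq> 0"
  by (simp add: of_nat_eq_0_iff_char_dvd CHAR_field)

text \<open>Exponents are indexed by Frobenius height: \<open>K 0\<close> belongs to d_(n,n) and
  \<open>K l\<close> to d_(n,n-l), up to sign.\<close>

definition dickson_mono :: "nat \<Rightarrow> (nat \<Rightarrow> nat) \<Rightarrow> 'f mpol" where
  "dickson_mono n K = (\<Prod>l<n. dickson_coeff p n l ^ K l)"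

lemma lessThan_split: "0 < n \<Longrightarrow> {..<n} = insert 0 {0<..<n :: nat}"
  by auto

lemma dickson_mono_power: "dickson_mono n K ^ e = dickson_mono n (\<lambda>l. e * K l)"
  by (simp add: dickson_mono_def prod_power_distrib power_mult[symmetric] mult.commute)

text \<open>The factors c_l with 0 < l < i have too small a level, so they are packed into
  \<open>g ^ p\<close>; c_0 and the c_l with l > i have level i and form \<open>h\<close>. The
  scalar is nonzero because p does not divide \<open>K i\<close>.\<close>

lemma reaches_trade:
  assumes i: "0 < i" "i < n" and dvd: "\<And>l. 0 < l \<Longrightarrow> l < i \<Longrightarrow> p dvd K l" and Ki: "\<not> p dvd K i"
  shows "reaches (dickson_mono n K) (dickson_mono n (K(i := K i - 1, 0 := Suc (K 0))))"
proof -
  let ?c = "dickson_coeff p n :: nat \<Rightarrow> 'f mpol"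
  define h where "h = ?c 0 ^ K 0 * (\<Prod>l\<in>{i<..<n}. ?c l ^ K l)"
  define g where "g = (\<Prod>l\<in>{0<..<i}. ?c l ^ (K l div p))"
  have gp: "g ^ p = (\<Prod>l\<in>{0<..<i}. ?c l ^ K l)"
    unfolding g_def prod_power_distrib
    by (intro prod.cong refl) (simp add: power_mult[symmetric] dvd)
  have sets: "{..<n} = insert 0 (insert i ({0<..<i} \<union> {i<..<n}))" using i by auto
  have split: "dickson_mono n L = ?c 0 ^ L 0 * (?c i ^ L i *
      ((\<Prod>l\<in>{0<..<i}. ?c l ^ L l) * (\<Prod>l\<in>{i<..<n}. ?c l ^ L l)))" for L
    unfolding dickson_mono_def sets using i
    by (subst prod.insert, simp, simp, subst prod.insert, simp, simp, subst prod.union_disjoint) auto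
  have K: "dickson_mono n K = h * ?c i ^ K i * g ^ p"
    unfolding split gp h_def by (simp only: mult_ac)
  have "(\<Prod>l\<in>A. ?c l ^ (K(i := K i - 1, 0 := Suc (K 0))) l) = (\<Prod>l\<in>A. ?c l ^ K l)"
    if "i \<notin> A" "0 \<notin> A" for A
    using that by (intro prod.cong refl) auto
  hence K': "dickson_mono n (K(i := K i - 1, 0 := Suc (K 0))) = h * ?c i ^ (K i - 1) * ?c 0 * g ^ p"
    unfolding split gp h_def using i by (simp add: mult_ac)
  have "level i h"
    unfolding h_def using i by (intro level_mult level_power level_prod level_dickson_coeff) auto
  from cascade_dickson_coeff_power[OF i this, of "K i" g] show ?thesis
    unfolding K K' by (rule reaches_cascade) (simp add: of_nat_field_neq_0 Ki)
qed

lemma reaches_increment: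
  assumes n: "0 < n" and dvd: "\<And>l. 0 < l \<Longrightarrow> l < n \<Longrightarrow> p dvd K l" and K0: "\<not> p dvd K 0"
  shows "reaches (dickson_mono n K) (dickson_mono n (K(0 := Suc (K 0))))"
proof -
  let ?c = "dickson_coeff p n :: nat \<Rightarrow> 'f mpol"
  define g where "g = (\<Prod>l\<in>{0<..<n}. ?c l ^ (K l div p))"
  have gp: "g ^ p = (\<Prod>l\<in>{0<..<n}. ?c l ^ K l)"
    unfolding g_def prod_power_distrib
    by (intro prod.cong refl) (simp add: power_mult[symmetric] dvd)
  have K: "dickson_mono n K = ?c 0 ^ K 0 * g ^ p"
    unfolding dickson_mono_def gp lessThan_split[OF n] by simp
  have K': "dickson_mono n (K(0 := Suc (K 0))) = ?c 0 ^ Suc (K 0) * g ^ p"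
    unfolding dickson_mono_def gp lessThan_split[OF n] by simp
  from cascade_dickson_coeff_0_power[OF n, of "K 0" g] show ?thesis
    unfolding K K' by (rule reaches_cascade) (simp add: of_nat_field_neq_0 K0)
qed

text \<open>Trading at the least offending index keeps the total exponent sum but lowers the sum
  over positive indices by one, so the process ends.\<close>

lemma reaches_dvd_positive:
  assumes n: "0 < n"
  shows "\<exists>K'. reaches (dickson_mono n K) (dickson_mono n K') \<and> (\<Sum>l<n. K' l) = (\<Sum>l<n. K l) \<and>
    (\<forall>l. 0 < l \<longrightarrow> l < n \<longrightarrow> p dvd K' l)"
proof (induction "\<Sum>l\<in>{0<..<n}. K l" arbitrary: K rule: less_induct)
  case less
  show ?case
  proof (cases "\<forall>l. 0 < l \<longrightarrow> l < n \<longrightarrow> p dvd K l")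
    case True
    thus ?thesis using reaches_refl by blast
  next
    case False
    define i where "i = (LEAST l. 0 < l \<and> l < n \<and> \<not> p dvd K l)"
    have i: "0 < i" "i < n" "\<not> p dvd K i"
      using LeastI_ex[of "\<lambda>l. 0 < l \<and> l < n \<and> \<not> p dvd K l"] False unfolding i_def by blast+
    have least: "p dvd K l" if "0 < l" "l < i" for l
      using not_less_Least[of l "\<lambda>l. 0 < l \<and> l < n \<and> \<not> p dvd K l"] that i unfolding i_def[symmetric]
      by auto
    have "K i > 0" using i(3) by (cases "K i") auto
    define L where "L = K(i := K i - 1, 0 := Suc (K 0))"
    have "(\<Sum>l\<in>{0<..<n} - {i}. L l) = (\<Sum>l\<in>{0<..<n} - {i}. K l)"
      by (rule sum.cong) (auto simp: L_def)
    hence S: "(\<Sum>l\<in>{0<..<n}. K l) = Suc (\<Sum>l\<in>{0<..<n}. L l)"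
      using i \<open>K i > 0\<close> by (simp add: sum.remove[of "{0<..<n}" i] L_def)
    obtain K' where K': "reaches (dickson_mono n L) (dickson_mono n K')"
      "(\<Sum>l<n. K' l) = (\<Sum>l<n. L l)" "\<forall>l. 0 < l \<longrightarrow> l < n \<longrightarrow> p dvd K' l"
      using less[of L] S by auto
    have "reaches (dickson_mono n K) (dickson_mono n L)"
      unfolding L_def using i least by (intro reaches_trade)
    moreover have "(\<Sum>l<n. L l) = (\<Sum>l<n. K l)"
      unfolding lessThan_split[OF n] by (simp add: S) (simp add: L_def)
    ultimately show ?thesis
      using K' reaches_trans by metis
  qed
qed

lemma reaches_raise:
  assumes n: "0 < n" and dvd: "\<And>l. 0 < l \<Longrightarrow> l < n \<Longrightarrow> p dvd K l"
    and "\<And>i. i < j \<Longrightarrow> \<not> p dvd K 0 + i"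
  shows "reaches (dickson_mono n K) (dickson_mono n (K(0 := K 0 + j)))"
  using assms(3)
proof (induction j)
  case (Suc j)
  have "reaches (dickson_mono n K) (dickson_mono n (K(0 := K 0 + j)))"
    using Suc.prems by (intro Suc.IH) simp
  also have "reaches \<dots> (dickson_mono n ((K(0 := K 0 + j))(0 := Suc ((K(0 := K 0 + j)) 0))))"
    using n dvd Suc.prems[of j] by (intro reaches_increment) auto
  finally show ?case by (simp only: fun_upd_upd fun_upd_same add_Suc_right)
qed (simp add: reaches_refl)

text \<open>After the trades only the exponent of c_0 may fail to be divisible by p; fewer than p
  increments repair it, which accounts for the two bounds.\<close>

lemma reaches_power_p_mono:
  assumes n: "0 < n"
  shows "\<exists>K'. reaches (dickson_mono n K) (dickson_mono n K' ^ p) \<and>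
    (\<Sum>l<n. K l) \<le> p * (\<Sum>l<n. K' l) \<and> p * (\<Sum>l<n. K' l) < (\<Sum>l<n. K l) + p"
proof -
  obtain L where L: "reaches (dickson_mono n K) (dickson_mono n L)"
    "(\<Sum>l<n. L l) = (\<Sum>l<n. K l)" "\<And>l. 0 < l \<Longrightarrow> l < n \<Longrightarrow> p dvd L l"
    using reaches_dvd_positive[OF n] by blast
  define j where "j = (LEAST j. p dvd L 0 + j)"
  \<comment> \<open>The outer \<open>mod p\<close> covers the case where p already divides
    \<open>L 0\<close>, and it bounds the least increment below p.\<close>
  have ex: "p dvd L 0 + (p - L 0 mod p) mod p"
    using p_pos by (metis dvd_eq_mod_eq_0 le_add_diff_inverse mod_add_left_eq mod_add_right_eq
      mod_le_divisor mod_self)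
  have j: "p dvd L 0 + j" unfolding j_def by (rule LeastI[of _ "(p - L 0 mod p) mod p"]) (rule ex)
  have "j \<le> (p - L 0 mod p) mod p" unfolding j_def by (rule Least_le) (rule ex)
  hence jp: "j < p" using p_pos by (meson le_less_trans mod_less_divisor)
  have least: "\<not> p dvd L 0 + i" if "i < j" for i
    using that not_less_Least unfolding j_def by blast
  define M where "M = L(0 := L 0 + j)"
  have M: "p dvd M l" if "l < n" for l
    using that L(3)[of l] j by (cases "l = 0") (auto simp: M_def)
  have "reaches (dickson_mono n L) (dickson_mono n M)"
    unfolding M_def using n L(3) least by (intro reaches_raise) auto
  moreover have "dickson_mono n M = dickson_mono n (\<lambda>l. M l div p) ^ p"
    unfolding dickson_mono_power unfolding dickson_mono_def by (intro prod.cong refl) (simp add: M)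
  moreover have "p * (\<Sum>l<n. M l div p) = (\<Sum>l<n. M l)"
    unfolding sum_distrib_left by (intro sum.cong refl) (simp add: M)
  moreover have "(\<Sum>l<n. M l) = (\<Sum>l<n. L l) + j"
    unfolding lessThan_split[OF n] by (simp add: M_def)
  ultimately show ?thesis
    using L(1,2) jp reaches_trans[OF L(1)] by (intro exI[of _ "\<lambda>l. M l div p"]) auto
qed

text \<open>Induction on the exponent sum: a sum of at least 2 strictly drops when a p-th root is
  extracted, and each extraction adds one to \<open>m\<close>.\<close>

lemma reaches_dickson_top:
  assumes n: "0 < n" and K: "(\<Sum>l<n. K l) > 0"
  shows "\<exists>m. reaches (dickson_mono n K) (dickson_coeff p n 0 ^ p ^ m)"
  using K
proof (induction "\<Sum>l<n. K l" arbitrary: K rule: less_induct)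
  case less
  show ?case
  proof (cases "(\<Sum>l<n. K l) = 1")
    case True
    obtain L where L: "reaches (dickson_mono n K) (dickson_mono n L)"
      "(\<Sum>l<n. L l) = 1" "\<And>l. 0 < l \<Longrightarrow> l < n \<Longrightarrow> p dvd L l"
      using reaches_dvd_positive[OF n, of K] True by metis
    \<comment> \<open>A total of 1 bounds every exponent by 1, and divisibility by p then forces 0
      at positive indices; the monomial is c_0 itself.\<close>
    have L0: "L l = 0" if "0 < l" "l < n" for l
    proof -
      have "L l \<le> 1" using member_le_sum[of l "{..<n}" L] that L(2) by simp
      with L(3)[OF that] p_ge_2 show ?thesis by (auto dest: dvd_imp_le)
    qed
    hence "(\<Sum>l\<in>{0<..<n}. L l) = 0" by simp
    hence "L 0 = 1" using L(2) unfolding lessThan_split[OF n] by simp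
    hence "dickson_mono n L = dickson_coeff p n 0 ^ p ^ 0"
      unfolding dickson_mono_def lessThan_split[OF n] using L0 by simp
    with L(1) show ?thesis by metis
  next
    case False
    obtain L where L: "reaches (dickson_mono n K) (dickson_mono n L ^ p)"
      "(\<Sum>l<n. K l) \<le> p * (\<Sum>l<n. L l)" "p * (\<Sum>l<n. L l) < (\<Sum>l<n. K l) + p"
      using reaches_power_p_mono[OF n] by blast
    have "(\<Sum>l<n. L l) < (\<Sum>l<n. K l)"
    proof (rule ccontr)
      \<comment> \<open>Since the sum is at least 2, writing it as N + 2 avoids truncated
        subtraction; without a drop, p*(N+2) < N+2+p would follow, impossible for p >= 2.\<close>
      define N where "N = (\<Sum>l<n. K l) - 2"
      assume "\<not> ?thesis"
      hence "N + 2 \<le> (\<Sum>l<n. L l)" using False less.prems by (simp add: N_def)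
      hence "p * (N + 2) \<le> p * (\<Sum>l<n. L l)" by (rule mult_le_mono2)
      also have "\<dots> < N + 2 + p" using L(3) False less.prems by (simp add: N_def)
      finally have "p * N + p < N + 2" by (simp add: algebra_simps)
      moreover have "N \<le> p * N" using p_pos by simp
      ultimately show False using p_ge_2 by simp
    qed
    moreover have "(\<Sum>l<n. L l) > 0" using L(2) less.prems
      by (metis gr0I le_zero_eq mult_0_right less_not_refl)
    ultimately obtain m where "reaches (dickson_mono n L) (dickson_coeff p n 0 ^ p ^ m)"
      using less.hyps by blast
    hence "reaches (dickson_mono n L ^ p) (dickson_coeff p n 0 ^ p ^ Suc m)"
      using reaches_power_p by (metis power_mult power_Suc mult.commute)
    thus ?thesis using L(1) reaches_trans by blast
  qed
qed

section \<open>Signs: from \<open>dickson_coeff\<close> back to the invariants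
  \<open>dickson\<close>\<close>

lemma dickson_eq: "i \<le> n \<Longrightarrow> dickson p n i = const_mpol ((-1) ^ i) * (dickson_coeff p n (n - i) :: 'f mpol)"
proof -
  have p1: "p > 1" using p_ge_2 by simp
  have "coeff (dickson_poly n) (p ^ (n - i)) = (\<Sum>k\<le>n. if k = n - i then dickson_coeff p n k else (0 :: 'f mpol))"
    using p1 by (simp add: dickson_poly_eq coeff_sum)
  thus ?thesis by (simp add: dickson_def const_mpol_power const_mpol_minus)
qed

lemma const_mpol_prod: "const_mpol (\<Prod>i\<in>A. f i) = (\<Prod>i\<in>A. const_mpol (f i))"
  by (induction A rule: infinite_finite_induct) (simp_all add: const_mpol_mult)

lemma prod_dickson_eq:
  "(\<Prod>i=1..n. dickson p n i ^ k i) =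
    const_mpol (\<Prod>i=1..n. ((-1) ^ i) ^ k i) * dickson_mono n (\<lambda>l. k (n - l))"
proof -
  have "(\<Prod>i=1..n. dickson p n i ^ k i) =
      (\<Prod>i=1..n. const_mpol (((-1) ^ i) ^ k i)) * (\<Prod>i=1..n. (dickson_coeff p n (n - i) :: 'f mpol) ^ k i)"
    unfolding prod.distrib[symmetric]
    by (intro prod.cong refl) (simp add: dickson_eq power_mult_distrib const_mpol_power)
  also have "(\<Prod>i=1..n. (dickson_coeff p n (n - i) :: 'f mpol) ^ k i) = dickson_mono n (\<lambda>l. k (n - l))"
    unfolding dickson_mono_def
    by (rule prod.reindex_bij_witness[of _ "\<lambda>l. n - l" "\<lambda>i. n - i"]) auto
  finally show ?thesis by (simp add: const_mpol_prod)
qed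

end

theorem mainTheorem5:
  fixes p n :: nat and k :: "nat \<Rightarrow> nat"
  assumes "prime p"
    and "card (UNIV :: 'f::field set) = p"
    and "\<exists>i\<in>{1..n}. k i \<noteq> 0"
  shows "\<exists>(rs :: nat list) (m :: nat) (u :: 'f). u \<noteq> 0 \<and>
           steenrod_comp p rs (\<Prod>i=1..n. (dickson p n i :: 'f mpol) ^ k i)
             = const_mpol u * (dickson p n n) ^ (p ^ m)"
proof -
  interpret fp_mpol p "TYPE('f)"
    using assms by unfold_locales
  obtain i where i: "i \<in> {1..n}" "k i \<noteq> 0" using assms by blast
  have "k (n - (n - i)) \<le> (\<Sum>l<n. k (n - l))"
    by (rule member_le_sum) (use i in auto)
  hence "(\<Sum>l<n. k (n - l)) > 0" using i by simp
  moreover have "0 < n" using i by simp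
  ultimately obtain m where "reaches (dickson_mono n (\<lambda>l. k (n - l))) (dickson_coeff p n 0 ^ p ^ m)"
    using reaches_dickson_top by blast
  then obtain rs u where u: "u \<noteq> 0" "steenrod_comp p rs (dickson_mono n (\<lambda>l. k (n - l))) =
      const_mpol u * dickson_coeff p n 0 ^ p ^ m"
    unfolding reaches_def by blast
  \<comment> \<open>\<open>s\<close> is the sign between d^K and its monomial in the c_l, and
    \<open>t\<close> the sign between d_(n,n)^(p^m) and c_0^(p^m); hence the final scalar
    \<open>s * u / t\<close>.\<close>
  define s where "s = (\<Prod>i=1..n. ((-1 :: 'f) ^ i) ^ k i)"
  define t where "t = ((-1 :: 'f) ^ n) ^ p ^ m"
  have "s \<noteq> 0" "t \<noteq> 0" by (simp_all add: s_def t_def)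
  have "(dickson p n n :: 'f mpol) ^ p ^ m = const_mpol t * dickson_coeff p n 0 ^ p ^ m"
    by (simp add: dickson_eq power_mult_distrib const_mpol_power t_def)
  hence "const_mpol (s * u / t) * (dickson p n n :: 'f mpol) ^ p ^ m =
      const_mpol (s * u / t * t) * dickson_coeff p n 0 ^ p ^ m"
    by (simp only: const_mpol_mult mult.assoc)
  also have "s * u / t * t = s * u" using \<open>t \<noteq> 0\<close> by simp
  also have "const_mpol (s * u) * dickson_coeff p n 0 ^ p ^ m =
      steenrod_comp p rs (\<Prod>i=1..n. (dickson p n i :: 'f mpol) ^ k i)"
    by (simp only: prod_dickson_eq steenrod_comp_const_mult u const_mpol_mult mult.assoc s_def)
  finally have eq: "const_mpol (s * u / t) * (dickson p n n :: 'f mpol) ^ p ^ m =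
      steenrod_comp p rs (\<Prod>i=1..n. (dickson p n i :: 'f mpol) ^ k i)" .
  show ?thesis
    by (rule exI[of _ rs], rule exI[of _ m], rule exI[of _ "s * u / t"])
      (use \<open>s \<noteq> 0\<close> \<open>t \<noteq> 0\<close> u(1) eq in simp)
qed

end
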